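(* Let $n,d\ge1$. To a complex polynomial of degree $d$ \[p(z_1,\dots,z_n)=\sum_{k=1}^d\ \sum_{i_1,\dots,i_k=1}^n a_{e_{i_1}+\cdots+e_{i_k}}z_{i_1}\cdots z_{i_k}\] associate, for $1\le k\le d$, the polynomial \[p_k=\sum_{i_1,\dots,i_k=1}^n a_{e_{i_1}+\cdots+e_{i_k}}\prod_{r=1}^k z_{n-i_r+1}z_{n-i_r+2}\cdots z_{n-1},\] which belongs to $\mathscr M^{(k)}_{n-1}$. Then the polynomial $p$ and the polynomials $p_1,\dots,p_d$ so obtained determine each other uniquely.
   Context: $e_j$ is the row vector of length $n$ with $1$ in position $j$ and $0$ elsewhere; the coefficients $a_{\boldsymbol\alpha}$ are indexed by multi-indices $\boldsymbol\alpha\in\mathbb N_0^n$. The monomial $z_{n-i+1}z_{n-i+2}\cdots z_{n-1}$ is the product of the last $i-1$ of the variables $z_1,\dots,z_{n-1}$, and equals $1$ when $i=1$. For $k\ge0$, $\mathscr M^{(k)}_{n-1}=\mathrm{span}\{z_1^{\alpha_1}z_2^{\alpha_2}\cdots z_{n-1}^{\alpha_{n-1}}:0\le\alpha_1\le\cdots\le\alpha_{n-1},\ \alpha_1+\cdots+\alpha_{n-1}\le(n-1)k\}$ (constants if $n=1$). *)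

theory Defs
  imports Complex_Main "HOL-Library.Poly_Mapping" "HOL-Library.FuncSet"
begin

text \<open>
  Complex polynomials in variables indexed by the natural numbers, as finitely supported
  functions from exponent vectors to coefficients; the product is the ring product
  of \<^theory>\<open>HOL-Library.Poly_Mapping\<close>. The variables actually used are indexed from \<open>1\<close>.
\<close>

type_synonym cpoly = "(nat \<Rightarrow>\<^sub>0 nat) \<Rightarrow>\<^sub>0 complex"

definition unit_index :: "nat \<Rightarrow> (nat \<Rightarrow>\<^sub>0 nat)" where
  "unit_index j = Poly_Mapping.single j 1"

definition Var :: "nat \<Rightarrow> cpoly" where
  "Var j = Poly_Mapping.single (unit_index j) 1"

definition scale_poly :: "complex \<Rightarrow> cpoly \<Rightarrow> cpoly" where
  "scale_poly c p = Poly_Mapping.single 0 c * p"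

interpretation cpoly: vector_space scale_poly
  by unfold_locales
    (simp_all add: scale_poly_def distrib_left distrib_right single_add mult_single
      flip: mult.assoc)

text \<open>The value at the zero polynomial is \<open>0\<close>.\<close>

definition total_degree :: "cpoly \<Rightarrow> nat" where
  "total_degree p =
     Max (insert 0 ((\<lambda>\<alpha>. \<Sum>i\<in>Poly_Mapping.keys \<alpha>. Poly_Mapping.lookup \<alpha> i) ` Poly_Mapping.keys p))"

text \<open>
  In the next two definitions the functions \<open>i\<close> are the tuples \<open>(i\<^sub>1, \<dots>, i\<^sub>k)\<close> with entries in
  \<open>{1..n}\<close>. Only the values of \<open>a\<close> at multi-indices supported in \<open>{1..n}\<close> are used.
\<close>

definition poly_of :: "nat \<Rightarrow> nat \<Rightarrow> ((nat \<Rightarrow>\<^sub>0 nat) \<Rightarrow> complex) \<Rightarrow> cpoly" where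
  "poly_of n d a =
     (\<Sum>k=1..d. \<Sum>i\<in>{1..k} \<rightarrow>\<^sub>E {1..n}.
        scale_poly (a (\<Sum>r=1..k. unit_index (i r))) (\<Prod>r=1..k. Var (i r)))"

definition assoc_poly :: "nat \<Rightarrow> ((nat \<Rightarrow>\<^sub>0 nat) \<Rightarrow> complex) \<Rightarrow> nat \<Rightarrow> cpoly" where
  "assoc_poly n a k =
     (\<Sum>i\<in>{1..k} \<rightarrow>\<^sub>E {1..n}.
        scale_poly (a (\<Sum>r=1..k. unit_index (i r)))
          (\<Prod>r=1..k. \<Prod>j=n - i r + 1..n - 1. Var j))"

text \<open>\<open>monotone_span m k\<close> is the space written with subscript \<open>m\<close> and superscript \<open>(k)\<close>.\<close>

definition monotone_span :: "nat \<Rightarrow> nat \<Rightarrow> cpoly set" where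
  "monotone_span m k =
     cpoly.span {\<Prod>j=1..m. Var j ^ \<alpha> j | \<alpha>. mono_on {1..m} \<alpha> \<and> (\<Sum>j=1..m. \<alpha> j) \<le> m * k}"

end

theory Submission
  imports Defs
begin

text \<open>
  A tuple \<open>i \<in> {1..n}\<^sup>k\<close> contributes to \<open>p\<close> a monomial whose exponents are the multiplicities
  \<open>#{r. i\<^sub>r = m}\<close>, and to \<open>p\<^sub>k\<close> a monomial whose exponents are the tail counts \<open>#{r. i\<^sub>r \<ge> m}\<close> for
  \<open>2 \<le> m \<le> n\<close>. The count for \<open>m = 1\<close> is \<open>k\<close>, so the tail counts determine the multiplicities by
  taking differences. Hence two tuples with the same monomial in \<open>p\<^sub>k\<close> have the same coefficient,
  and as no cancellation can occur among equal coefficients in characteristic \<open>0\<close>, the polynomials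
  on either side determine exactly the numbers \<open>a\<^sub>\<alpha>\<close> with \<open>1 \<le> |\<alpha>| \<le> d\<close>.
\<close>

lemma prod_single:
  fixes f :: "'i \<Rightarrow> 'a::comm_monoid_add" and c :: "'i \<Rightarrow> 'b::comm_semiring_1"
  shows "(\<Prod>x\<in>X. Poly_Mapping.single (f x) (c x)) = Poly_Mapping.single (\<Sum>x\<in>X. f x) (\<Prod>x\<in>X. c x)"
  by (induction X rule: infinite_finite_induct) (simp_all add: mult_single)

lemma Var_power: "Var j ^ m = Poly_Mapping.single (Poly_Mapping.single j m) 1"
  by (induction m) (simp_all add: Var_def unit_index_def mult_single flip: single_add)

lemma scale_poly_single: "scale_poly c (Poly_Mapping.single \<alpha> x) = Poly_Mapping.single \<alpha> (c * x)"
  by (simp add: scale_poly_def mult_single)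

text \<open>The key \<open>f j\<close> collects the values over the fibre of \<open>f\<close>
  through \<open>j\<close>. As these values agree, its coefficient is the fibre size times
  \<open>u j\<close>, and the size is a nonzero factor in characteristic 0. So \<open>f\<close> may
  be far from injective.\<close>

lemma sum_single_eq_iff:
  fixes u v :: "'i \<Rightarrow> 'b::{idom, ring_char_0}"
  assumes "finite A"
    and u: "\<And>i j. i \<in> A \<Longrightarrow> j \<in> A \<Longrightarrow> f i = f j \<Longrightarrow> u i = u j"
    and v: "\<And>i j. i \<in> A \<Longrightarrow> j \<in> A \<Longrightarrow> f i = f j \<Longrightarrow> v i = v j"
  shows "(\<Sum>i\<in>A. Poly_Mapping.single (f i) (u i)) = (\<Sum>i\<in>A. Poly_Mapping.single (f i) (v i))
    \<longleftrightarrow> (\<forall>i\<in>A. u i = v i)"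
proof
  assume eq: "(\<Sum>i\<in>A. Poly_Mapping.single (f i) (u i)) = (\<Sum>i\<in>A. Poly_Mapping.single (f i) (v i))"
  have coeff: "Poly_Mapping.lookup (\<Sum>i\<in>A. Poly_Mapping.single (f i) (w i)) (f j)
      = of_nat (card {i \<in> A. f i = f j}) * w j"
    if "j \<in> A" and w: "\<And>i. i \<in> A \<Longrightarrow> f i = f j \<Longrightarrow> w i = w j" for w :: "'i \<Rightarrow> 'b" and j
  proof -
    have "Poly_Mapping.lookup (\<Sum>i\<in>A. Poly_Mapping.single (f i) (w i)) (f j)
        = (\<Sum>i\<in>A. if f i = f j then w j else 0)"
      using w by (auto simp: lookup_sum lookup_single when_def intro!: sum.cong)
    also have "\<dots> = (\<Sum>i\<in>{i \<in> A. f i = f j}. w j)"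
      using \<open>finite A\<close> by (simp only: sum.inter_filter)
    finally show ?thesis by simp
  qed
  show "\<forall>i\<in>A. u i = v i"
  proof
    fix j assume j: "j \<in> A"
    have "card {i \<in> A. f i = f j} \<noteq> 0"
      using \<open>finite A\<close> j by auto
    moreover have "of_nat (card {i \<in> A. f i = f j}) * u j = of_nat (card {i \<in> A. f i = f j}) * v j"
      using coeff[of j u, OF j u[OF _ j]] coeff[of j v, OF j v[OF _ j]] unfolding eq by (rule trans[OF sym])
    ultimately show "u j = v j" by simp
  qed
qed simp

definition tail_count :: "nat \<Rightarrow> (nat \<Rightarrow> nat) \<Rightarrow> nat \<Rightarrow> nat" where
  "tail_count k i m = card {r \<in> {1..k}. m \<le> i r}"

lemma tail_count_le: "tail_count k i m \<le> k"
  unfolding tail_count_def by (rule order_trans[OF card_mono[of "{1..k}"]]) auto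

lemma tail_count_antimono: "m \<le> m' \<Longrightarrow> tail_count k i m' \<le> tail_count k i m"
  unfolding tail_count_def by (rule card_mono) auto

text \<open>The variable \<open>Var j\<close> occurs in the factor for \<open>r\<close> exactly when
  \<open>n - j + 1 \<le> i r\<close>. Exchanging the two products turns these occurrences into a
  tail count.\<close>

lemma prod_tail_Var:
  "(\<Prod>r=1..k. \<Prod>j=n - i r + 1..n - 1. Var j) =
   (\<Prod>j=1..n - 1. Var j ^ tail_count k i (n - j + 1))"
proof -
  have "(\<Prod>r=1..k. \<Prod>j=n - i r + 1..n - 1. Var j) =
      (\<Prod>r=1..k. \<Prod>j=1..n - 1. if n - j + 1 \<le> i r then Var j else 1)"
  proof (rule prod.cong[OF refl])
    fix r
    \<comment> \<open>Truncated subtraction keeps this true also for \<open>i r\<close> outside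
      \<open>{1..n}\<close>.\<close>
    have "{n - i r + 1..n - 1} = {j \<in> {1..n - 1}. n - j + 1 \<le> i r}" by auto
    then show "(\<Prod>j=n - i r + 1..n - 1. Var j) =
        (\<Prod>j=1..n - 1. if n - j + 1 \<le> i r then Var j else 1)"
      by (simp only: prod.inter_filter finite_atLeastAtMost)
  qed
  also have "\<dots> = (\<Prod>j=1..n - 1. \<Prod>r=1..k. if n - j + 1 \<le> i r then Var j else 1)"
    by (rule prod.swap)
  also have "\<dots> = (\<Prod>j=1..n - 1. Var j ^ tail_count k i (n - j + 1))"
    unfolding tail_count_def
    by (simp only: prod_constant finite_atLeastAtMost flip: prod.inter_filter)
  finally show ?thesis .
qed

text \<open>A multiplicity is the difference of two consecutive tail counts; the additive form
  avoids truncated subtraction.\<close>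

lemma lookup_sum_unit_index:
  "Poly_Mapping.lookup (\<Sum>r=1..k. unit_index (i r)) m + tail_count k i (Suc m) = tail_count k i m"
proof -
  have "Poly_Mapping.lookup (\<Sum>r=1..k. unit_index (i r)) m = card {r \<in> {1..k}. i r = m}"
    by (simp add: lookup_sum unit_index_def lookup_single when_def flip: sum.inter_filter)
  moreover have "{r \<in> {1..k}. m \<le> i r} = {r \<in> {1..k}. i r = m} \<union> {r \<in> {1..k}. Suc m \<le> i r}"
    by auto
  moreover have "{r \<in> {1..k}. i r = m} \<inter> {r \<in> {1..k}. Suc m \<le> i r} = {}"
    by auto
  ultimately show ?thesis
    unfolding tail_count_def by (simp add: card_Un_disjoint)
qed

text \<open>The assumption covers the thresholds from 2 to \<open>n\<close>. All other tail counts
  are forced by the range of the entries: \<open>k\<close> at thresholds up to 1, and 0 above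
  \<open>n\<close>. Differences then give all multiplicities.\<close>

lemma sum_unit_index_eqI:
  assumes i: "i \<in> {1..k} \<rightarrow>\<^sub>E {1..n}" and i': "i' \<in> {1..k} \<rightarrow>\<^sub>E {1..n}"
    and eq: "\<And>j. j \<in> {1..n - 1} \<Longrightarrow> tail_count k i (n - j + 1) = tail_count k i' (n - j + 1)"
  shows "(\<Sum>r=1..k. unit_index (i r)) = (\<Sum>r=1..k. unit_index (i' r))"
proof -
  have low: "tail_count k h m = k" if "m \<le> 1" "h \<in> {1..k} \<rightarrow>\<^sub>E {1..n}" for h m
  proof -
    have "{r \<in> {1..k}. m \<le> h r} = {1..k}" using that by (fastforce dest: PiE_mem)
    then show ?thesis by (simp add: tail_count_def)
  qed
  have high: "tail_count k h m = 0" if "n < m" "h \<in> {1..k} \<rightarrow>\<^sub>E {1..n}" for h m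
  proof -
    have "{r \<in> {1..k}. m \<le> h r} = {}" using that by (fastforce dest: PiE_mem)
    then show ?thesis by (simp only: tail_count_def card.empty)
  qed
  have "tail_count k i m = tail_count k i' m" for m
  proof -
    consider "m \<le> 1" | "n < m" | "1 < m" "m \<le> n" by linarith
    then show ?thesis
    proof cases
      case 3
      \<comment> \<open>The index is chosen to solve \<open>n - j + 1 = m\<close>; it lies in
        \<open>{1..n - 1}\<close> because \<open>2 \<le> m \<le> n\<close>.\<close>
      then show ?thesis using eq[of "n - m + 1"] by simp
    qed (use low high i i' in simp_all)
  qed
  then show ?thesis
    by (intro poly_mapping_eqI) (metis lookup_sum_unit_index add_right_cancel)
qed

text \<open>As \<open>j\<close> grows the threshold \<open>n - j + 1\<close> falls, so the exponents
  increase; each of the \<open>n - 1\<close> exponents is at most \<open>k\<close>.\<close>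

lemma assoc_poly_in_monotone_span: "assoc_poly n a k \<in> monotone_span (n - 1) k"
proof -
  have "(\<Prod>j=1..n - 1. Var j ^ tail_count k i (n - j + 1)) \<in>
      {\<Prod>j=1..n - 1. Var j ^ \<alpha> j | \<alpha>. mono_on {1..n - 1} \<alpha> \<and> (\<Sum>j=1..n - 1. \<alpha> j) \<le> (n - 1) * k}"
    for i
  proof -
    have "mono_on {1..n - 1} (\<lambda>j. tail_count k i (n - j + 1))"
      by (rule mono_onI) (auto intro: tail_count_antimono)
    moreover have "(\<Sum>j=1..n - 1. tail_count k i (n - j + 1)) \<le> (n - 1) * k"
      using sum_bounded_above[of "{1..n - 1}" "\<lambda>j. tail_count k i (n - j + 1)" k] tail_count_le
      by simp
    ultimately show ?thesis
      by (intro CollectI exI[of _ "\<lambda>j. tail_count k i (n - j + 1)"] conjI refl)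
  qed
  then show ?thesis
    unfolding assoc_poly_def monotone_span_def prod_tail_Var
    by (intro cpoly.span_sum cpoly.span_scale cpoly.span_base)
qed

text \<open>All degrees merge into one sum over pairs \<open>(k, i)\<close>. The coefficient is
  \<open>a\<close> evaluated at the exponent itself, so it is constant on fibres.\<close>

lemma poly_of_eq_iff:
  "poly_of n d a = poly_of n d b \<longleftrightarrow>
   (\<forall>k\<in>{1..d}. \<forall>i\<in>{1..k} \<rightarrow>\<^sub>E {1..n}.
      a (\<Sum>r=1..k. unit_index (i r)) = b (\<Sum>r=1..k. unit_index (i r)))"
proof -
  let ?S = "\<lambda>(k, i). \<Sum>r=1..k. unit_index (i r)"
  let ?A = "SIGMA k:{1..d}. {1..k} \<rightarrow>\<^sub>E {1..n}"
  have "poly_of n d c = (\<Sum>x\<in>?A. Poly_Mapping.single (?S x) (c (?S x)))" for c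
    by (simp add: poly_of_def Var_def prod_single scale_poly_single sum.Sigma finite_PiE case_prod_unfold)
  moreover have "finite ?A"
    by (auto intro: finite_PiE)
  ultimately show ?thesis
    by (simp add: sum_single_eq_iff)
qed

lemma assoc_poly_eq_iff:
  "assoc_poly n a k = assoc_poly n b k \<longleftrightarrow>
   (\<forall>i\<in>{1..k} \<rightarrow>\<^sub>E {1..n}. a (\<Sum>r=1..k. unit_index (i r)) = b (\<Sum>r=1..k. unit_index (i r)))"
proof -
  let ?S = "\<lambda>i. \<Sum>r=1..k. unit_index (i r)"
  let ?T = "\<lambda>i. \<Sum>j=1..n - 1. Poly_Mapping.single j (tail_count k i (n - j + 1))"
  let ?A = "{1..k} \<rightarrow>\<^sub>E {1..n}"
  have assoc: "assoc_poly n c k = (\<Sum>i\<in>?A. Poly_Mapping.single (?T i) (c (?S i)))" for c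
    by (simp only: assoc_poly_def prod_tail_Var Var_power prod_single scale_poly_single
        prod.neutral_const mult_1_right)
  have T: "Poly_Mapping.lookup (?T i) j = tail_count k i (n - j + 1)" if "j \<in> {1..n - 1}" for i j
    using that by (simp add: lookup_sum lookup_single when_def)
  \<comment> \<open>Here key \<open>?T i\<close> and argument \<open>?S i\<close> differ, so
    constancy on fibres needs that \<open>?T i\<close> determines \<open>?S i\<close>. It is shown
    for any \<open>c\<close>, to serve both \<open>a\<close> and \<open>b\<close>.\<close>
  have "c (?S i) = c (?S i')" if "i \<in> ?A" "i' \<in> ?A" "?T i = ?T i'" for c :: "_ \<Rightarrow> complex" and i i'
    by (rule arg_cong, rule sum_unit_index_eqI[OF that(1,2)]) (simp only: that(3) flip: T)
  then show ?thesis
    unfolding assoc by (intro sum_single_eq_iff finite_PiE finite_atLeastAtMost)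
qed

theorem mainTheorem9:
  fixes n d :: nat and a :: "(nat \<Rightarrow>\<^sub>0 nat) \<Rightarrow> complex"
  assumes "n \<ge> 1" and "d \<ge> 1"
    and "total_degree (poly_of n d a) = d"
  shows "(\<forall>k\<in>{1..d}. assoc_poly n a k \<in> monotone_span (n - 1) k) \<and>
         (\<forall>b. poly_of n d a = poly_of n d b \<longleftrightarrow>
              (\<forall>k\<in>{1..d}. assoc_poly n a k = assoc_poly n b k))"
  using assoc_poly_in_monotone_span unfolding poly_of_eq_iff assoc_poly_eq_iff by blast

end
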